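(* Let $(q,n)$ be a Dickson pair with $q=p^l$, $p$ prime, and $n>2$; let $g$ be a primitive element of $\mathbb{F}_{q^n}$, and let $b\in DN_g(q,n)$ be such that $b\neq 0$ and $1+b\neq 0$. Let $s,t$ be non-negative integers with $b\in g^{\frac{q^s-1}{q-1}}H$ and $1+b\in g^{\frac{q^t-1}{q-1}}H$, and put $\mu=\gcd(s,t,n)$. Then $\mathbb{F}_{q^{\mu}}$ is the unique largest subfield of $\mathbb{F}_{q^n}$ contained in $D(1,b)$.
   Context: A pair $(q,n)$ of positive integers is a Dickson pair if $q=p^l$ is a power of a prime $p$, every prime divisor of $n$ divides $q-1$, and $4\nmid n$ whenever $q\equiv 3\pmod 4$. Let $g$ be a primitive element of $\mathbb{F}_{q^n}$ (a generator of $\mathbb{F}_{q^n}^*$) and let $H=\langle g^n\rangle\le \mathbb{F}_{q^n}^*$. The cosets $g^{\frac{q^k-1}{q-1}}H$, $0\le k\le n-1$, are exactly the $n$ distinct cosets of $H$ in $\mathbb{F}_{q^n}^*$. The Dickson nearfield $DN_g(q,n)=(\mathbb{F}_{q^n},+,\circ)$ has the addition of the field and multiplication $0\circ y=0$, and $x\circ y=x\cdot y^{q^k}$ if $x\in g^{\frac{q^k-1}{q-1}}H$ (so $\circ$ is left distributive: $x\circ(y+z)=x\circ y+x\circ z$). Here $\cdot$ (or juxtaposition) and powers refer to the field multiplication. For $a,b\in DN_g(q,n)$ the generalized distributive set is $D(a,b)=\{d\in DN_g(q,n)\mid (a+b)\circ d=a\circ d+b\circ d\}$. For $r\mid n$,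 $\mathbb{F}_{q^r}$ denotes the unique subfield of $\mathbb{F}_{q^n}$ of order $q^r$. "Largest" is with respect to inclusion: every subfield of $\mathbb{F}_{q^n}$ contained in $D(1,b)$ is contained in it. *)

theory Defs
  imports "HOL-Algebra.Algebra" "HOL-Number_Theory.Prime_Powers"
begin

definition dickson_pair :: "nat \<Rightarrow> nat \<Rightarrow> bool" where
  "dickson_pair q n \<longleftrightarrow>
     primepow q \<and> n > 0 \<and>
     (\<forall>r. Factorial_Ring.prime r \<and> r dvd n \<longrightarrow> r dvd q - 1) \<and>
     (q mod 4 = 3 \<longrightarrow> \<not> 4 dvd n)"

definition primitive_element :: "('a, 'm) ring_scheme \<Rightarrow> 'a \<Rightarrow> bool" where
  "primitive_element F g \<longleftrightarrow>
     g \<in> carrier (mult_of F) \<and> generate (mult_of F) {g} = carrier (mult_of F)"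

definition dickson_subgroup :: "('a, 'm) ring_scheme \<Rightarrow> 'a \<Rightarrow> nat \<Rightarrow> 'a set" where
  "dickson_subgroup F g n = generate (mult_of F) {g [^]\<^bsub>F\<^esub> n}"

(* The division is exact because q - 1 divides q ^ k - 1. *)
definition dickson_coset :: "('a, 'm) ring_scheme \<Rightarrow> 'a \<Rightarrow> nat \<Rightarrow> nat \<Rightarrow> nat \<Rightarrow> 'a set" where
  "dickson_coset F g q n k =
     (g [^]\<^bsub>F\<^esub> ((q ^ k - 1) div (q - 1))) <#\<^bsub>mult_of F\<^esub> dickson_subgroup F g n"

(* For a Dickson pair (q, n) and a primitive element g, the cosets with index k < n
   partition the nonzero elements, so the description below determines k. *)
definition dickson_index :: "('a, 'm) ring_scheme \<Rightarrow> 'a \<Rightarrow> nat \<Rightarrow> nat \<Rightarrow> 'a \<Rightarrow> nat" where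
  "dickson_index F g q n x = (THE k. k < n \<and> x \<in> dickson_coset F g q n k)"

(* The ring record serves only as a signature here: in general the multiplication is
   distributive on one side only, x o (y + z) = x o y + x o z. *)
definition dickson_nearfield :: "('a, 'm) ring_scheme \<Rightarrow> 'a \<Rightarrow> nat \<Rightarrow> nat \<Rightarrow> 'a ring" where
  "dickson_nearfield F g q n =
     \<lparr>carrier = carrier F,
      monoid.mult = (\<lambda>x y. if x = \<zero>\<^bsub>F\<^esub> then \<zero>\<^bsub>F\<^esub>
                    else x \<otimes>\<^bsub>F\<^esub> y [^]\<^bsub>F\<^esub> (q ^ dickson_index F g q n x)),
      one = \<one>\<^bsub>F\<^esub>, ring.zero = \<zero>\<^bsub>F\<^esub>, ring.add = ring.add F\<rparr>"

definition gen_dist_set :: "('a, 'm) ring_scheme \<Rightarrow> 'a \<Rightarrow> 'a \<Rightarrow> 'a set" where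
  "gen_dist_set N a b =
     {d \<in> carrier N. (a \<oplus>\<^bsub>N\<^esub> b) \<otimes>\<^bsub>N\<^esub> d = a \<otimes>\<^bsub>N\<^esub> d \<oplus>\<^bsub>N\<^esub> b \<otimes>\<^bsub>N\<^esub> d}"

(* In a field with q ^ n elements, q a prime power, there is exactly one subfield with
   q ^ r elements whenever r divides n. *)
definition subfield_of_order :: "('a, 'm) ring_scheme \<Rightarrow> nat \<Rightarrow> 'a set" where
  "subfield_of_order F m = (THE K. subfield K F \<and> card K = m)"

definition largest_subfield_in :: "('a, 'm) ring_scheme \<Rightarrow> 'a set \<Rightarrow> 'a set \<Rightarrow> bool" where
  "largest_subfield_in F D K \<longleftrightarrow>
     subfield K F \<and> K \<subseteq> D \<and> (\<forall>L. subfield L F \<and> L \<subseteq> D \<longrightarrow> L \<subseteq> K)"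

end

theory Submission
  imports Defs "HOL-Number_Theory.Cong"
begin

text \<open>For a Dickson pair, \<open>(q\<^sup>j - 1) / (q - 1)\<close> and \<open>(q\<^sup>k - 1) / (q - 1)\<close> are congruent modulo
  \<open>n\<close> only if \<open>j\<close> and \<open>k\<close> are. So the coset index of an element is well defined, and \<open>D(1, b)\<close>
  consists of the \<open>d\<close> with \<open>(1 + b) \<tau>(d) = d + b \<sigma>(d)\<close>, where \<open>\<sigma>(d)\<close> is the \<open>q\<^sup>s\<close>-th and
  \<open>\<tau>(d)\<close> the \<open>q\<^sup>t\<close>-th power of \<open>d\<close>. On a subfield contained in \<open>D(1, b)\<close> the characters
  \<open>id\<close>, \<open>\<sigma>\<close>, \<open>\<tau>\<close> satisfy a linear relation with nonzero coefficients \<open>1\<close>, \<open>b\<close>, \<open>1 + b\<close>; by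
  Dedekind's argument they all coincide there. Hence the largest such subfield is the common fixed
  field of \<open>\<sigma>\<close> and \<open>\<tau>\<close>.\<close>

section \<open>Quotients of powers modulo n\<close>

lemma sum_power_mult_diff_one:
  fixes q :: nat
  assumes "q \<ge> 1"
  shows "(q - 1) * (\<Sum>i<k. q ^ i) = q ^ k - 1"
proof -
  have "(q - 1) * (\<Sum>i<k. q ^ i) + 1 = q ^ k"
  proof (induction k)
    case (Suc k)
    have "(q - 1) * (\<Sum>i<Suc k. q ^ i) + 1 = ((q - 1) * (\<Sum>i<k. q ^ i) + 1) + (q - 1) * q ^ k"
      by (simp add: algebra_simps)
    also have "\<dots> = (1 + (q - 1)) * q ^ k"
      unfolding Suc.IH by (simp add: algebra_simps)
    also have "\<dots> = q ^ Suc k" using assms by simp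
    finally show ?case .
  qed simp
  then show ?thesis by simp
qed

lemma sum_power_eq_div:
  fixes q :: nat
  assumes "q \<ge> 2"
  shows "(q ^ k - 1) div (q - 1) = (\<Sum>i<k. q ^ i)"
  using assms sum_power_mult_diff_one[of q k] by (metis Suc_1 Suc_le_lessD diff_is_0_eq leD
      nonzero_mult_div_cancel_left order.strict_implies_order)

lemma sum_power_add:
  fixes q :: nat
  shows "(\<Sum>i<a + b. q ^ i) = (\<Sum>i<a. q ^ i) + q ^ a * (\<Sum>i<b. q ^ i)"
  by (induction b) (simp_all add: algebra_simps power_add)

text \<open>The \<open>r * m\<close> terms are grouped into \<open>m\<close> blocks of length
  \<open>r\<close>. This lets \<open>dvd_sum_power_iff\<close> split off one prime factor at a
  time.\<close>

lemma sum_power_mult: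
  fixes q :: nat
  shows "(\<Sum>i<r * m. q ^ i) = (\<Sum>i<r. q ^ i) * (\<Sum>i<m. (q ^ r) ^ i)"
proof (induction m)
  case (Suc m)
  have "(\<Sum>i<r * Suc m. q ^ i) = (\<Sum>i<r * m + r. q ^ i)"
    by (simp add: add.commute)
  also have "\<dots> = (\<Sum>i<r. q ^ i) * (\<Sum>i<Suc m. (q ^ r) ^ i)"
    unfolding sum_power_add Suc.IH by (simp add: algebra_simps flip: power_mult)
  finally show ?case .
qed simp

lemma cong_sum_power:
  fixes q r :: nat
  assumes "[q = 1] (mod r)"
  shows "[(\<Sum>i<m. q ^ i) = m] (mod r)"
proof -
  have "[(\<Sum>i<m. q ^ i) = (\<Sum>i<m. 1)] (mod r)"
    using cong_pow[OF assms] by (intro cong_sum) simp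
  then show ?thesis by simp
qed

text \<open>With \<open>q = 1 + r * x\<close>, the power \<open>q ^ i\<close> is
  \<open>1 + i * r * x\<close> modulo \<open>r * r\<close>. Hence the sum is \<open>r\<close> plus
  \<open>r * x\<close> times \<open>r * (r - 1) / 2\<close>, and for odd \<open>r\<close> this last
  factor is a multiple of \<open>r\<close>. For \<open>r = 2\<close> the sum is
  \<open>q + 1\<close>, which 4 divides when \<open>q mod 4 = 3\<close>.\<close>

lemma not_square_dvd_sum_power:
  fixes q r :: nat
  assumes "Factorial_Ring.prime r" and "r \<noteq> 2" and "[q = 1] (mod r)" and "q > 0"
  shows "\<not> r * r dvd (\<Sum>i<r. q ^ i)"
proof
  assume dvd: "r * r dvd (\<Sum>i<r. q ^ i)"
  obtain x where x: "q = 1 + r * x"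
    using cong_to_1_nat[OF assms(3)] assms(4) by (metis dvdE le_add_diff_inverse less_eq_Suc_le One_nat_def)
  have pow: "[q ^ i = 1 + i * (r * x)] (mod r * r)" for i
  proof (induction i)
    case (Suc i)
    have "[q ^ Suc i = (1 + r * x) * (1 + i * (r * x))] (mod r * r)"
      unfolding power_Suc x[symmetric] by (intro cong_mult Suc.IH) simp
    also have "(1 + r * x) * (1 + i * (r * x)) = 1 + Suc i * (r * x) + (r * r) * (i * x * x)"
      by (simp add: algebra_simps)
    also have "[\<dots> = 1 + Suc i * (r * x)] (mod r * r)"
      by (simp add: cong_def)
    finally show ?case .
  qed simp
  have "odd r" using assms(1,2) by (simp add: prime_odd_nat prime_ge_2_nat le_neq_implies_less)
  moreover have "2 * (\<Sum>i<r. i) = r * (r - 1)"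
    by (induction r) (auto simp: algebra_simps)
  ultimately have "r dvd (\<Sum>i<r. i)"
    by (metis coprime_dvd_mult_right_iff coprime_right_2_iff_odd dvd_triv_left)
  then obtain c where c: "(\<Sum>i<r. i) = r * c" by (elim dvdE)
  have "[(\<Sum>i<r. q ^ i) = (\<Sum>i<r. 1 + i * (r * x))] (mod r * r)"
    by (intro cong_sum pow)
  also have "(\<Sum>i<r. 1 + i * (r * x)) = r + (\<Sum>i<r. i) * (r * x)"
    by (simp only: sum.distrib sum_distrib_right) simp
  also have "\<dots> = r + (r * r) * (c * x)" unfolding c by (simp add: algebra_simps)
  also have "[\<dots> = r] (mod r * r)" by (simp add: cong_def)
  finally have "r * r dvd r" using dvd cong_dvd_iff by blast
  then show False using assms(1) by (auto dest: dvd_imp_le prime_gt_1_nat simp: prime_gt_0_nat)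
qed

text \<open>For a prime \<open>r\<close> dividing \<open>n = r k\<close>, the sum over \<open>i < r m'\<close> is the sum over \<open>i < r\<close> times
  the sum over \<open>i < m'\<close> for \<open>q\<^sup>r\<close>. The first factor is \<open>r u\<close> with \<open>u\<close> prime to \<open>k\<close>, so the
  claim for \<open>n\<close> and \<open>q\<close> reduces to that for \<open>k\<close> and \<open>q\<^sup>r\<close>.\<close>

lemma dvd_sum_power_iff:
  fixes q n m :: nat
  assumes "n > 0" and "q > 0"
    and "\<And>r. Factorial_Ring.prime r \<Longrightarrow> r dvd n \<Longrightarrow> [q = 1] (mod r)"
    and "q mod 4 = 3 \<Longrightarrow> \<not> 4 dvd n"
  shows "n dvd (\<Sum>i<m. q ^ i) \<longleftrightarrow> n dvd m"
  using assms
proof (induction n arbitrary: q m rule: less_induct)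
  case (less n)
  show ?case
  proof (cases "n = 1")
    case False
    then obtain r where r: "Factorial_Ring.prime r" "r dvd n" using prime_factor_nat by blast
    then obtain k where k: "n = r * k" by (elim dvdE)
    have qr: "[q = 1] (mod r)" using less.prems(3) r .
    have "r dvd (\<Sum>i<r. q ^ i)" using cong_dvd_iff[OF cong_sum_power[OF qr, of r]] by simp
    then obtain u where u: "(\<Sum>i<r. q ^ i) = r * u" by (elim dvdE)
    \<comment> \<open>Modulo a common prime \<open>s\<close> of \<open>u\<close> and
      \<open>k\<close> the sum is both 0 and \<open>r\<close>, so \<open>s = r\<close> and
      \<open>r * r\<close> divides the sum as well as \<open>n\<close>. That leaves
      \<open>r = 2\<close>, where \<open>4 dvd q + 1\<close> and \<open>4 dvd n\<close> violate the
      condition modulo 4.\<close>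
    have "coprime u k"
    proof (rule ccontr)
      assume "\<not> coprime u k"
      then obtain s where s: "Factorial_Ring.prime s" "s dvd u" "s dvd k"
        by (metis coprime_iff_gcd_eq_1 dvd_trans gcd_dvd1 gcd_dvd2 prime_factor_nat)
      have "s dvd n" using s k by simp
      then have "[q = 1] (mod s)" using less.prems(3) s by simp
      then have "s dvd r" using cong_dvd_iff[OF cong_sum_power[of q s r]] s(2) u by simp
      then have [simp]: "s = r" using r(1) s(1) primes_dvd_imp_eq by blast
      have sq: "r * r dvd (\<Sum>i<r. q ^ i)" "r * r dvd n" using s k u by auto
      then have [simp]: "r = 2" using not_square_dvd_sum_power[OF r(1) _ qr less.prems(2)] by blast
      have "(\<Sum>i<2. q ^ i) = q + 1" by (simp add: numeral_2_eq_2)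
      then have "4 dvd q + 1" using sq(1) by simp
      then have "q mod 4 = 3" by presburger
      then show False using less.prems(4) sq by simp
    qed
    show ?thesis
    proof (cases "r dvd m")
      \<comment> \<open>Modulo \<open>r\<close> the sum is \<open>m\<close>, so here both sides of
        the equivalence fail.\<close>
      case False
      then have "\<not> r dvd (\<Sum>i<m. q ^ i)" using cong_dvd_iff[OF cong_sum_power[OF qr, of m]] by simp
      then show ?thesis using False r(2) dvd_trans by blast
    next
      case True
      then obtain m' where m': "m = r * m'" by (elim dvdE)
      have "r > 0" using r(1) by (simp add: prime_gt_0_nat)
      have "n dvd (\<Sum>i<m. q ^ i) \<longleftrightarrow> k dvd u * (\<Sum>i<m'. (q ^ r) ^ i)"
        unfolding m' sum_power_mult u k using \<open>r > 0\<close> by simp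
      also have "\<dots> \<longleftrightarrow> k dvd (\<Sum>i<m'. (q ^ r) ^ i)"
        using \<open>coprime u k\<close> by (simp add: coprime_commute coprime_dvd_mult_right_iff)
      also have "\<dots> \<longleftrightarrow> k dvd m'"
      proof (rule less.IH)
        show "k < n" using k r(1) less.prems(1) prime_gt_1_nat by auto
        show "k > 0" using k less.prems(1) by auto
        show "q ^ r > 0" using less.prems(2) by simp
        show "[q ^ r = 1] (mod s)" if "Factorial_Ring.prime s" "s dvd k" for s
          using cong_pow[OF less.prems(3)[OF that(1)], of r] that k by simp
        \<comment> \<open>The residue 3 of \<open>q ^ r\<close> can only come from the residue 3 of
          \<open>q\<close>: positive powers of even numbers stay even, and powers of 1 stay 1 modulo
          4.\<close>
        show "\<not> 4 dvd k" if "q ^ r mod 4 = 3"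
        proof -
          have "odd q"
          proof
            assume "even q"
            then have "even (q ^ r)" using \<open>r > 0\<close> by simp
            then show False using that by presburger
          qed
          moreover have "q mod 4 \<noteq> 1"
          proof
            assume "q mod 4 = 1"
            then have "[q ^ r = 1 ^ r] (mod 4)" by (intro cong_pow) (simp add: cong_def)
            then show False using that by (simp add: cong_def)
          qed
          ultimately have "q mod 4 = 3" by presburger
          then show ?thesis using less.prems(4) k by auto
        qed
      qed
      also have "\<dots> \<longleftrightarrow> n dvd m" using k m' \<open>r > 0\<close> by simp
      finally show ?thesis .
    qed
  qed simp
qed

text \<open>For \<open>j \<le> k\<close> the two sums differ by \<open>q ^ j\<close> times a sum of
  \<open>k - j\<close> terms, and \<open>q\<close> is invertible modulo \<open>n\<close>, so
  \<open>dvd_sum_power_iff\<close> applies.\<close>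

lemma cong_sum_power_iff:
  fixes q n j k :: nat
  assumes "n > 0" and "q > 0"
    and "\<And>r. Factorial_Ring.prime r \<Longrightarrow> r dvd n \<Longrightarrow> [q = 1] (mod r)"
    and "q mod 4 = 3 \<Longrightarrow> \<not> 4 dvd n"
  shows "[(\<Sum>i<j. q ^ i) = (\<Sum>i<k. q ^ i)] (mod n) \<longleftrightarrow> [j = k] (mod n)"
proof (induction j k rule: linorder_wlog)
  case (le j k)
  have "coprime q n"
  proof (rule ccontr)
    assume "\<not> coprime q n"
    then obtain s where s: "Factorial_Ring.prime s" "s dvd q" "s dvd n"
      by (metis coprime_iff_gcd_eq_1 dvd_trans gcd_dvd1 gcd_dvd2 prime_factor_nat)
    then have "s dvd 1" using cong_dvd_iff[OF assms(3)] by blast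
    then show False using s(1) by simp
  qed
  define d where "d = k - j"
  have k: "k = j + d" using le d_def by simp
  have "[(\<Sum>i<j. q ^ i) = (\<Sum>i<k. q ^ i)] (mod n) \<longleftrightarrow> n dvd q ^ j * (\<Sum>i<d. q ^ i)"
    unfolding k sum_power_add by (metis cong_0_iff cong_add_lcancel_0_nat cong_sym_eq)
  also have "\<dots> \<longleftrightarrow> n dvd (\<Sum>i<d. q ^ i)"
    using \<open>coprime q n\<close> by (simp add: coprime_commute coprime_dvd_mult_right_iff)
  also have "\<dots> \<longleftrightarrow> n dvd d" by (rule dvd_sum_power_iff[OF assms])
  also have "\<dots> \<longleftrightarrow> [j = k] (mod n)"
    unfolding k by (metis cong_0_iff cong_add_lcancel_0_nat cong_sym_eq)
  finally show ?case .
next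
  case (sym j k)
  then show ?case by (simp add: cong_sym_eq)
qed

section \<open>Frobenius powers and subfields of finite fields\<close>

lemma (in cring) binomial_expansion:
  fixes n :: nat
  assumes [simp]: "x \<in> carrier R" "y \<in> carrier R"
  shows "(x \<oplus> y) [^] n = (\<Oplus>k\<in>{..n}. add_pow R (n choose k) (x [^] k \<otimes> y [^] (n - k)))"
proof (induction n)
  case (Suc n)
  let ?f = "\<lambda>k. add_pow R (n choose k) (x [^] Suc k \<otimes> y [^] (n - k))"
  let ?g = "\<lambda>k. add_pow R (n choose k) (x [^] k \<otimes> y [^] (Suc n - k))"
  let ?h = "\<lambda>k. add_pow R (Suc n choose k) (x [^] k \<otimes> y [^] (Suc n - k))"
  have "(x \<oplus> y) [^] Suc n = (\<Oplus>k\<in>{..n}. add_pow R (n choose k) (x [^] k \<otimes> y [^] (n - k))) \<otimes> x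
      \<oplus> (\<Oplus>k\<in>{..n}. add_pow R (n choose k) (x [^] k \<otimes> y [^] (n - k))) \<otimes> y"
    unfolding nat_pow_Suc Suc.IH by (intro r_distr) auto
  also have "(\<Oplus>k\<in>{..n}. add_pow R (n choose k) (x [^] k \<otimes> y [^] (n - k))) \<otimes> x = (\<Oplus>k\<in>{..n}. ?f k)"
  proof (subst finsum_ldistr)
    show "(\<Oplus>k\<in>{..n}. add_pow R (n choose k) (x [^] k \<otimes> y [^] (n - k)) \<otimes> x) = (\<Oplus>k\<in>{..n}. ?f k)"
      by (rule add.finprod_cong') (auto simp: add_pow_ldistr add_pow_rdistr m_ac)
  qed auto
  also have "(\<Oplus>k\<in>{..n}. add_pow R (n choose k) (x [^] k \<otimes> y [^] (n - k))) \<otimes> y = (\<Oplus>k\<in>{..n}. ?g k)"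
  proof (subst finsum_ldistr)
    show "(\<Oplus>k\<in>{..n}. add_pow R (n choose k) (x [^] k \<otimes> y [^] (n - k)) \<otimes> y) = (\<Oplus>k\<in>{..n}. ?g k)"
      by (rule add.finprod_cong') (auto simp: add_pow_ldistr add_pow_rdistr m_ac Suc_diff_le)
  qed auto
  \<comment> \<open>The added term has coefficient \<open>n choose Suc n = 0\<close>. It lets
    \<open>?g\<close> be shifted by one and combined with \<open>?f\<close> by Pascal's
    rule.\<close>
  also have "(\<Oplus>k\<in>{..n}. ?g k) = (\<Oplus>k\<in>{..Suc n}. ?g k)"
    by (subst finsum_Suc) (auto simp: binomial_eq_0)
  also have "\<dots> = (\<Oplus>k\<in>{..n}. ?g (Suc k)) \<oplus> ?g 0"
    by (subst finsum_Suc2) auto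
  also have "(\<Oplus>k\<in>{..n}. ?f k) \<oplus> \<dots> = ((\<Oplus>k\<in>{..n}. ?f k) \<oplus> (\<Oplus>k\<in>{..n}. ?g (Suc k))) \<oplus> ?g 0"
    by (subst a_assoc) auto
  also have "(\<Oplus>k\<in>{..n}. ?f k) \<oplus> (\<Oplus>k\<in>{..n}. ?g (Suc k)) = (\<Oplus>k\<in>{..n}. ?f k \<oplus> ?g (Suc k))"
    by (subst finsum_addf) auto
  also have "\<dots> = (\<Oplus>k\<in>{..n}. ?h (Suc k))"
    by (rule add.finprod_cong') (auto simp: add.nat_pow_mult)
  also have "\<dots> \<oplus> ?g 0 = (\<Oplus>k\<in>{..n}. ?h (Suc k)) \<oplus> ?h 0" by simp
  also have "\<dots> = (\<Oplus>k\<in>{..Suc n}. ?h k)"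
    by (subst finsum_Suc2) auto
  finally show ?case .
qed simp

lemma (in cring) frobenius_add:
  fixes p k :: nat
  assumes p: "Factorial_Ring.prime p" "add_pow R p \<one> = \<zero>"
    and "x \<in> carrier R" "y \<in> carrier R"
  shows "(x \<oplus> y) [^] (p ^ k) = x [^] (p ^ k) \<oplus> y [^] (p ^ k)"
  using assms(3,4)
proof (induction k arbitrary: x y)
  case (Suc k)
  note [simp] = Suc.prems
  have zero: "add_pow R m z = \<zero>" if "p dvd m" "z \<in> carrier R" for m :: nat and z
  proof -
    obtain c where c: "m = p * c" using \<open>p dvd m\<close> by (elim dvdE)
    have "add_pow R p z = (add_pow R p \<one>) \<otimes> z" using that by (simp add: add_pow_ldistr)
    then have "add_pow R p z = \<zero>" using that p by simp
    then have "add_pow R c (add_pow R p z) = \<zero>" by simp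
    then show ?thesis unfolding c using that by (simp add: add.nat_pow_pow)
  qed
  \<comment> \<open>The inner indices from 1 to \<open>p - 1\<close> become \<open>Suc i\<close>
    with \<open>i \<le> m\<close>. Their binomial coefficients are multiples of \<open>p\<close>, so
    only the two end terms survive.\<close>
  obtain m where m: "p = Suc (Suc m)"
    using prime_ge_2_nat[OF p(1)] by (metis Suc_diff_le Suc_le_D numeral_2_eq_2 Suc_le_mono)
  let ?h = "\<lambda>i. add_pow R (p choose i) (x [^] i \<otimes> y [^] (p - i))"
  have "(x \<oplus> y) [^] p = (\<Oplus>i\<in>{..p}. ?h i)" by (rule binomial_expansion) auto
  also have "\<dots> = ?h p \<oplus> ((\<Oplus>i\<in>{..m}. ?h (Suc i)) \<oplus> ?h 0)"
    unfolding m by (subst finsum_Suc, simp, subst finsum_Suc2, auto)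
  also have "(\<Oplus>i\<in>{..m}. ?h (Suc i)) = \<zero>"
  proof -
    have "(\<Oplus>i\<in>{..m}. ?h (Suc i)) = (\<Oplus>i\<in>{..m}. \<zero>)"
    proof (rule add.finprod_cong')
      fix i assume "i \<in> {..m}"
      then have "p dvd p choose Suc i" using p(1) m by (intro dvd_choose_prime) auto
      then show "?h (Suc i) = \<zero>" by (intro zero) auto
    qed auto
    then show ?thesis by simp
  qed
  also have "?h p \<oplus> (\<zero> \<oplus> ?h 0) = x [^] p \<oplus> y [^] p" by simp
  finally have "((x \<oplus> y) [^] p) [^] (p ^ k) = (x [^] p) [^] (p ^ k) \<oplus> (y [^] p) [^] (p ^ k)"
    by (simp add: Suc.IH)
  then show ?case by (simp add: nat_pow_pow)
qed simp

text \<open>Lagrange in the additive group makes the \<open>p ^ k\<close>-fold sum of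
  \<open>\<one>\<close> vanish. This sum is the \<open>k\<close>-th power of the
  \<open>p\<close>-fold one, and a domain has no nonzero nilpotent elements.\<close>

lemma (in domain) prime_add_pow_one_eq_zero:
  fixes p k :: nat
  assumes "order R = p ^ k"
  shows "add_pow R p \<one> = \<zero>"
proof -
  have "add_pow R (p ^ j) \<one> = (add_pow R p \<one>) [^] j" for j
  proof (induction j)
    case (Suc j)
    have "add_pow R (p ^ Suc j) \<one> = add_pow R (p ^ j) (add_pow R p \<one>)" by (simp add: add.nat_pow_pow mult.commute)
    also have "\<dots> = (add_pow R (p ^ j) \<one>) \<otimes> (add_pow R p \<one>)" by (simp add: add_pow_ldistr)
    finally show ?case using Suc.IH by simp
  qed simp
  moreover have "add_pow R (order R) \<one> = \<zero>"
    using group.pow_order_eq_1[OF a_group, of \<one>] by (simp add: add_pow_def order_def)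
  ultimately have "(add_pow R p \<one>) [^] k = \<zero>" using assms by simp
  moreover have "z = \<zero>" if "z [^] j = \<zero>" "z \<in> carrier R" for z and j :: nat
    using that by (induction j) (auto dest: integral)
  ultimately show ?thesis by simp
qed

lemma (in field) subfield_fixed_points:
  fixes p e k :: nat
  assumes p: "Factorial_Ring.prime p" "order R = p ^ e"
  shows "subfield {x \<in> carrier R. x [^] (p ^ k) = x} R"
proof (rule subfieldI')
  note add = frobenius_add[OF p(1) prime_add_pow_one_eq_zero[OF p(2)]]
  have "p ^ k \<noteq> 0" using p(1) by auto
  then have zero: "\<zero> [^] (p ^ k) = \<zero>" by (simp add: nat_pow_zero)
  show "subring {x \<in> carrier R. x [^] (p ^ k) = x} R"
  proof (rule subringI)
    fix x assume "x \<in> {x \<in> carrier R. x [^] (p ^ k) = x}"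
    then have x: "x \<in> carrier R" "x [^] (p ^ k) = x" by auto
    \<comment> \<open>Uniqueness of the additive inverse then treats \<open>p = 2\<close> and odd
      \<open>p\<close> alike.\<close>
    have "x \<oplus> (\<ominus> x) [^] (p ^ k) = \<zero>"
      using add[of x "\<ominus> x" k] x zero by (simp add: r_neg)
    then have "(\<ominus> x) [^] (p ^ k) = \<ominus> x"
      using x by (metis a_inv_closed add.inv_equality a_comm nat_pow_closed)
    then show "\<ominus> x \<in> {x \<in> carrier R. x [^] (p ^ k) = x}" using x by simp
  qed (auto simp: add nat_pow_distrib)
  fix x assume "x \<in> {x \<in> carrier R. x [^] (p ^ k) = x} - {\<zero>}"
  then have x: "x \<in> carrier R" "x [^] (p ^ k) = x" "x \<in> Units R" using field_Units by auto
  then have "inv x \<otimes> x = \<one>" "inv x \<in> carrier R" by auto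
  then have "(inv x) [^] (p ^ k) \<otimes> x = \<one>"
    using x nat_pow_distrib[of "inv x" x "p ^ k"] by simp
  then have "(inv x) [^] (p ^ k) = inv x"
    using x by (metis Units_inv_closed inv_char m_comm nat_pow_closed)
  then show "inv x \<in> {x \<in> carrier R. x [^] (p ^ k) = x}" using x by simp
qed

section \<open>Counting fixed points and identifying subfields by their order\<close>

text \<open>The degree of the polynomial bounds the number of roots from above. From below, a
  generator of the cyclic multiplicative group raised to the power \<open>(order R - 1) / N\<close>
  generates \<open>N\<close> roots.\<close>

lemma (in field) card_roots_of_unity:
  fixes N :: nat
  assumes fin: "finite (carrier R)" and "N dvd order R - 1" and "N > 0"
  shows "card {x \<in> carrier R. x [^] N = \<one>} = N"
proof (rule antisym)
  show "card {x \<in> carrier R. x [^] N = \<one>} \<le> N"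
    using num_roots_le_deg[OF fin, of N] assms(3) by simp
  interpret G: group "Multiplicative_Group.mult_of R" by (rule field_mult_group)
  obtain a where a: "a \<in> carrier (Multiplicative_Group.mult_of R)" "carrier (Multiplicative_Group.mult_of R) = {a [^] i | i::nat. i \<in> UNIV}"
    using finite_field_mult_group_has_gen[OF fin] by auto
  have finM: "finite (carrier (Multiplicative_Group.mult_of R))" using fin by simp
  have "generate (Multiplicative_Group.mult_of R) {a} = carrier (Multiplicative_Group.mult_of R)"
    using G.generate_pow_nat[OF a(1)] G.ord_ge_1[OF finM a(1)] a(2) by (simp add: Multiplicative_Group.nat_pow_mult_of)
  then have ord: "G.ord a = order R - 1"
    using G.generate_pow_card[OF a(1)] order_mult_of[OF fin] by (simp add: order_def)
  obtain c where c: "order R - 1 = c * N" using assms(2) by (metis dvdE mult.commute)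
  have "c > 0" using c ord G.ord_ge_1[OF finM a(1)] by (cases c) auto
  let ?h = "a [^]\<^bsub>Multiplicative_Group.mult_of R\<^esub> c"
  have h: "?h \<in> carrier (Multiplicative_Group.mult_of R)" using a(1) by (rule G.nat_pow_closed)
  have ordh: "G.ord ?h = N"
    using G.ord_pow_gen[OF a(1), of c] \<open>c > 0\<close> unfolding ord c by simp
  have "generate (Multiplicative_Group.mult_of R) {?h} \<subseteq> {x \<in> carrier R. x [^] N = \<one>}"
  proof
    fix x assume x: "x \<in> generate (Multiplicative_Group.mult_of R) {?h}"
    have "x \<in> carrier (Multiplicative_Group.mult_of R)" using x h G.generate_incl[of "{?h}"] by blast
    moreover obtain i :: nat where "x = ?h [^]\<^bsub>Multiplicative_Group.mult_of R\<^esub> i"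
      using x G.generate_pow_nat[OF h] ordh \<open>N > 0\<close> by auto
    then have "x [^]\<^bsub>Multiplicative_Group.mult_of R\<^esub> N = (?h [^]\<^bsub>Multiplicative_Group.mult_of R\<^esub> N) [^]\<^bsub>Multiplicative_Group.mult_of R\<^esub> i"
      using h by (simp only: G.nat_pow_pow mult.commute)
    then have "x [^]\<^bsub>Multiplicative_Group.mult_of R\<^esub> N = \<one>"
      using G.pow_ord_eq_1[OF h] unfolding ordh using G.nat_pow_one[of i] by simp
    ultimately show "x \<in> {x \<in> carrier R. x [^] N = \<one>}" by (simp add: Multiplicative_Group.nat_pow_mult_of)
  qed
  then show "N \<le> card {x \<in> carrier R. x [^] N = \<one>}"
    using card_mono[OF _ \<open>_ \<subseteq> _\<close>] fin G.generate_pow_card[OF h] ordh by simp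
qed

lemma (in field) card_fixed_points:
  fixes Q :: nat
  assumes fin: "finite (carrier R)" and "Q - 1 dvd order R - 1" and "Q > 1"
  shows "card {x \<in> carrier R. x [^] Q = x} = Q"
proof -
  have "x [^] Q = x \<longleftrightarrow> x = \<zero> \<or> x [^] (Q - 1) = \<one>" if x: "x \<in> carrier R" for x
  proof -
    have "x [^] Q = x [^] (Q - 1) \<otimes> x"
      using nat_pow_Suc[of x "Q - 1"] assms(3) by simp
    then show ?thesis using x m_rcancel[of x "x [^] (Q - 1)" \<one>] by auto
  qed
  then have "{x \<in> carrier R. x [^] Q = x} = insert \<zero> {x \<in> carrier R. x [^] (Q - 1) = \<one>}" by auto
  moreover have "\<zero> \<notin> {x \<in> carrier R. x [^] (Q - 1) = \<one>}"
    using assms(3) by (simp add: nat_pow_zero)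
  ultimately show ?thesis
    using card_roots_of_unity[OF fin assms(2)] assms(3) fin by simp
qed

lemma (in field) subfield_pow_card:
  assumes "subfield K R" and "finite K" and x: "x \<in> K"
  shows "x [^] card K = x"
proof (cases "x = \<zero>")
  case True
  have "card K \<noteq> 0" using assms by auto
  then show ?thesis using True by (simp add: nat_pow_zero)
next
  case False
  interpret K: field "R\<lparr>carrier := K\<rparr>" using subfield_iff(2)[OF assms(1)] .
  interpret G: group "Multiplicative_Group.mult_of (R\<lparr>carrier := K\<rparr>)" by (rule K.field_mult_group)
  have "x [^]\<^bsub>Multiplicative_Group.mult_of (R\<lparr>carrier := K\<rparr>)\<^esub> (card K - 1) = \<one>"
    using G.pow_order_eq_1[of x] False x K.order_mult_of \<open>finite K\<close>
    by (simp add: order_def)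
  then have "x [^] (card K - 1) = \<one>"
    by (simp add: Multiplicative_Group.nat_pow_mult_of flip: nat_pow_consistent)
  moreover have "card K = Suc (card K - 1)" using assms by (metis Suc_diff_1 card_gt_0_iff empty_iff)
  moreover have "x \<in> carrier R" using assms(1) x subfieldE(3) by blast
  ultimately show ?thesis by (metis l_one nat_pow_Suc)
qed

text \<open>Replaces the definite description by a concrete set. By Lagrange any subfield with
  \<open>p ^ k\<close> elements lies in the set of fixed points, which has \<open>p ^ k\<close>
  elements itself.\<close>

lemma (in field) subfield_of_order_eq:
  fixes p k n :: nat
  assumes p: "Factorial_Ring.prime p" and fin: "finite (carrier R)"
    and ord: "order R = p ^ n" and k: "k dvd n" "k > 0"
  shows "subfield_of_order R (p ^ k) = {x \<in> carrier R. x [^] (p ^ k) = x}" (is "_ = ?K")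
  unfolding subfield_of_order_def
proof (rule the_equality)
  have "p ^ k > 1" using prime_gt_1_nat[OF p] k by (intro one_less_power)
  moreover have "p ^ k - 1 dvd order R - 1"
  proof -
    obtain c where c: "n = k * c" using k by (elim dvdE)
    have "(p ^ k - 1) * (\<Sum>i<c. (p ^ k) ^ i) = order R - 1"
      unfolding ord c power_mult using \<open>p ^ k > 1\<close> by (intro sum_power_mult_diff_one) simp
    then show ?thesis by (metis dvd_triv_left)
  qed
  ultimately have card: "card ?K = p ^ k" using card_fixed_points[OF fin] by blast
  then show "subfield ?K R \<and> card ?K = p ^ k" using subfield_fixed_points[OF p ord] by simp
  fix L assume L: "subfield L R \<and> card L = p ^ k"
  then have LR: "L \<subseteq> carrier R" using subfieldE(3) by blast
  then have "finite L" using fin finite_subset by blast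
  then have "x [^] (p ^ k) = x" if "x \<in> L" for x using subfield_pow_card[of L x] L that by metis
  then have "L \<subseteq> ?K" using LR by blast
  then show "L = ?K" using card L fin by (intro card_subset_eq) auto
qed

section \<open>Fixed points of iterated \<open>q\<close>-th powers\<close>

lemma (in monoid) pow_power_mod:
  fixes q k n :: nat
  assumes x: "x \<in> carrier G" and fix_n: "x [^] (q ^ n) = x"
  shows "x [^] (q ^ (k mod n)) = x [^] (q ^ k)"
proof -
  have "x [^] (q ^ (n * j)) = x" for j
  proof (induction j)
    case (Suc j)
    have "x [^] (q ^ (n * Suc j)) = (x [^] (q ^ n)) [^] (q ^ (n * j))"
      using x by (simp add: nat_pow_pow power_add)
    then show ?case using Suc.IH fix_n by simp
  qed (use x in simp)
  then have "x [^] (q ^ (k mod n)) = (x [^] (q ^ (n * (k div n)))) [^] (q ^ (k mod n))" by simp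
  also have "\<dots> = x [^] (q ^ (n * (k div n) + k mod n))"
    using x by (simp only: nat_pow_pow power_add)
  finally show ?thesis by simp
qed

text \<open>The exponents \<open>j\<close> for which the \<open>q ^ j\<close>-th power fixes
  \<open>x\<close> are stable under the remainder step of Euclid's algorithm.\<close>

lemma (in monoid) pow_power_gcd:
  fixes q j k :: nat
  assumes x: "x \<in> carrier G" and "x [^] (q ^ j) = x" and "x [^] (q ^ k) = x"
  shows "x [^] (q ^ gcd j k) = x"
  using assms(2,3)
proof (induction j k rule: gcd_nat_induct)
  case (step m n)
  then show ?case using pow_power_mod[OF x, of q n m] by (simp add: gcd_red_nat[of m n])
qed simp

lemma (in monoid) pow_power_dvd:
  fixes q j k :: nat
  assumes "x \<in> carrier G" and "x [^] (q ^ j) = x" and "j dvd k"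
  shows "x [^] (q ^ k) = x"
  using pow_power_mod[OF assms(1,2), of k] assms by simp

text \<open>Dedekind's elimination for three characters. It rests on the multiplicativity of powers,
  so \<open>u\<close> and \<open>v\<close> can be arbitrary exponents.\<close>

lemma (in field) subfield_pow_relation_imp_fixed:
  fixes u v :: nat
  assumes L: "subfield L R"
    and b: "b \<in> carrier R" "b \<noteq> \<zero>" "\<one> \<oplus> b \<noteq> \<zero>"
    and rel: "\<And>d. d \<in> L \<Longrightarrow> (\<one> \<oplus> b) \<otimes> d [^] u = d \<oplus> b \<otimes> d [^] v"
    and d: "d \<in> L"
  shows "d [^] u = d" and "d [^] v = d"
proof -
  have carr: "x \<in> carrier R" if "x \<in> L" for x using that subfieldE(3)[OF L] by blast
  \<comment> \<open>The relation at \<open>c \<otimes> d\<close>, rewritten by the relation at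
    \<open>c\<close>, is compared with \<open>c\<close> times the relation at \<open>d\<close>. The
    difference is \<open>b \<otimes> ((C \<ominus> c) \<otimes> (U \<ominus> V)) =
    \<zero>\<close>.\<close>
  have split: "d [^] u = d [^] v" if c: "c \<in> L" "c [^] v \<noteq> c" and d: "d \<in> L" for c d
  proof -
    note [simp] = carr[OF c(1)] carr[OF d] b(1)
    define C U V where "C = c [^] v" and "U = d [^] u" and "V = d [^] v"
    have CUV [simp]: "C \<in> carrier R" "U \<in> carrier R" "V \<in> carrier R"
      by (simp_all add: C_def U_def V_def)
    have cd: "c \<otimes> d \<in> L" using c(1) d subringE(6)[OF subfieldE(1)[OF L]] by blast
    have "(\<one> \<oplus> b) \<otimes> (c [^] u \<otimes> U) = c \<otimes> d \<oplus> b \<otimes> (C \<otimes> V)"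
      using rel[OF cd] by (simp add: nat_pow_distrib C_def U_def V_def)
    moreover have "(\<one> \<oplus> b) \<otimes> (c [^] u \<otimes> U) = (c \<oplus> b \<otimes> C) \<otimes> U"
      using rel[OF c(1)] by (simp add: C_def flip: m_assoc)
    ultimately have 1: "(c \<oplus> b \<otimes> C) \<otimes> U = c \<otimes> d \<oplus> b \<otimes> (C \<otimes> V)" by simp
    have 2: "c \<otimes> ((\<one> \<oplus> b) \<otimes> U) = c \<otimes> (d \<oplus> b \<otimes> V)"
      using rel[OF d] by (simp add: U_def V_def)
    have "b \<otimes> ((C \<ominus> c) \<otimes> (U \<ominus> V)) =
        ((c \<oplus> b \<otimes> C) \<otimes> U \<ominus> (c \<otimes> d \<oplus> b \<otimes> (C \<otimes> V)))
        \<ominus> (c \<otimes> ((\<one> \<oplus> b) \<otimes> U) \<ominus> c \<otimes> (d \<oplus> b \<otimes> V))"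
      using CUV carr[OF c(1)] carr[OF d] b(1) by algebra
    also have "\<dots> = \<zero>" unfolding 1 2 by (simp add: minus_eq r_neg)
    finally have "b \<otimes> ((C \<ominus> c) \<otimes> (U \<ominus> V)) = \<zero>" .
    moreover have "C \<ominus> c \<noteq> \<zero>" using c by (simp add: C_def)
    ultimately have "U \<ominus> V = \<zero>" using b(2) by (auto dest!: integral)
    then show ?thesis by (simp add: U_def V_def)
  qed
  \<comment> \<open>An element moved by \<open>v\<close> may serve as its own \<open>c\<close> in
    \<open>split\<close>. The relation then collapses to the equation it was assumed to
    violate.\<close>
  have v: "d [^] v = d" if d: "d \<in> L" for d
  proof (rule ccontr)
    assume neq: "d [^] v \<noteq> d"
    note [simp] = carr[OF d] b(1)
    have "d [^] v \<oplus> b \<otimes> d [^] v = d \<oplus> b \<otimes> d [^] v"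
      using rel[OF d] split[OF d neq d] by (simp add: l_distr)
    then show False using neq by simp
  qed
  note [simp] = carr[OF d] b(1)
  have "(\<one> \<oplus> b) \<otimes> d [^] u = (\<one> \<oplus> b) \<otimes> d"
    using rel[OF d] v[OF d] by (simp add: l_distr)
  then show "d [^] u = d" using b(3) by (simp add: m_lcancel)
  show "d [^] v = d" by (rule v[OF d])
qed

section \<open>The Dickson nearfield\<close>

text \<open>HOL-Algebra has two constants \<open>mult_of\<close>; the definitions of this development use the one
  from \<open>Ring_Divisibility\<close>, the theory of cyclic groups the other one.\<close>

lemma mult_of_eq: "Ring_Divisibility.mult_of R = Multiplicative_Group.mult_of R"
  unfolding Ring_Divisibility.mult_of_def Multiplicative_Group.mult_of_def ..

text \<open>In a finite group natural exponents already exhaust a cyclic subgroup, so coset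
  membership becomes a condition on exponents of \<open>g\<close>.\<close>

lemma (in field) mem_dickson_coset_iff:
  assumes fin: "finite (carrier R)" and g: "primitive_element R g"
  shows "x \<in> dickson_coset R g q n k \<longleftrightarrow> (\<exists>i::nat. x = g [^] ((q ^ k - 1) div (q - 1) + n * i))"
proof -
  interpret G: group "Multiplicative_Group.mult_of R" by (rule field_mult_group)
  have gc: "g \<in> carrier R" "g \<in> carrier (Multiplicative_Group.mult_of R)"
    using g by (auto simp: primitive_element_def mult_of_eq)
  have gn: "g [^] n \<in> carrier (Multiplicative_Group.mult_of R)"
    using G.nat_pow_closed[OF gc(2), of n] by (simp only: Multiplicative_Group.nat_pow_mult_of)
  have "G.ord (g [^] n) \<noteq> 0" using G.ord_ge_1[OF _ gn] fin by simp
  then have "dickson_subgroup R g n = {(g [^] n) [^] i | i::nat. i \<in> UNIV}"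
    unfolding dickson_subgroup_def mult_of_eq G.generate_pow_nat[OF gn \<open>_ \<noteq> 0\<close>]
      Multiplicative_Group.nat_pow_mult_of by simp
  then show ?thesis
    using gc(1) by (auto simp: dickson_coset_def l_coset_def nat_pow_pow nat_pow_mult)
qed

lemma (in field) primitive_element_pow_eq_imp_cong:
  fixes i j :: nat
  assumes fin: "finite (carrier R)" and g: "primitive_element R g" and eq: "g [^] i = g [^] j"
  shows "[i = j] (mod order R - 1)"
proof -
  interpret G: group "Multiplicative_Group.mult_of R" by (rule field_mult_group)
  have gc: "g \<in> carrier (Multiplicative_Group.mult_of R)"
    using g by (auto simp: primitive_element_def mult_of_eq)
  have "G.ord g = order R - 1"
    using G.generate_pow_card[OF gc] order_mult_of[OF fin] g
    by (simp add: primitive_element_def mult_of_eq order_def)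
  moreover have "int (G.ord g) dvd int j - int i"
    using G.int_pow_eq[OF gc, of "int i" "int j"] eq
    by (simp add: int_pow_int Multiplicative_Group.nat_pow_mult_of)
  ultimately show ?thesis by (metis cong_iff_dvd_diff cong_int_iff cong_sym)
qed

text \<open>Evaluates the definite description for a coset number \<open>k\<close> of any size, as
  needed for \<open>s\<close> and \<open>t\<close>. Equal powers of \<open>g\<close> have congruent
  exponents modulo \<open>q ^ n - 1\<close>, hence modulo \<open>n\<close>, and
  \<open>cong_sum_power_iff\<close> recovers the index.\<close>

lemma (in field) dickson_index_eq:
  assumes pair: "dickson_pair q n" and fin: "finite (carrier R)" and ord: "order R = q ^ n"
    and g: "primitive_element R g" and x: "x \<in> dickson_coset R g q n k"
  shows "dickson_index R g q n x = k mod n"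
proof -
  have q: "q \<ge> 2" and n: "n > 0"
    using pair by (auto simp: dickson_pair_def primepow_gt_Suc_0 Suc_le_eq numeral_2_eq_2)
  have prime: "[q = 1] (mod r)" if "Factorial_Ring.prime r" "r dvd n" for r
    using pair that q by (intro iffD2[OF cong_altdef_nat]) (auto simp: dickson_pair_def)
  have mod4: "\<not> 4 dvd n" if "q mod 4 = 3" using pair that by (simp add: dickson_pair_def)
  have cong_iff: "[(\<Sum>i<j. q ^ i) = (\<Sum>i<k. q ^ i)] (mod n) \<longleftrightarrow> [j = k] (mod n)" for j k
    using q by (intro cong_sum_power_iff n prime mod4) auto
  have "n dvd (\<Sum>i<n. q ^ i)" using cong_iff[of n 0] by (simp add: cong_0_iff)
  then have ndvd: "n dvd order R - 1"
    unfolding ord using sum_power_mult_diff_one[of q n] q by (metis dvd_mult one_le_numeral order_trans)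
  note mem = mem_dickson_coset_iff[OF fin g, of _ q n, unfolded sum_power_eq_div[OF q]]
  obtain i where i: "x = g [^] ((\<Sum>i<k. q ^ i) + n * i)" using x mem by blast
  show ?thesis
    unfolding dickson_index_def
  proof (rule the_equality)
    \<comment> \<open>The inequality turns the congruence into an equation with a natural number
      \<open>c\<close>, as the exponents in \<open>mem\<close> are natural.\<close>
    have "(\<Sum>i<k mod n. q ^ i) \<le> (\<Sum>i<k. q ^ i)" by (intro sum_mono2) auto
    moreover have "[(\<Sum>i<k. q ^ i) = (\<Sum>i<k mod n. q ^ i)] (mod n)" unfolding cong_iff by (simp add: cong_def)
    ultimately obtain c where "(\<Sum>i<k. q ^ i) = (\<Sum>i<k mod n. q ^ i) + n * c"
      by (metis cong_le_nat mult.commute add.commute)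
    then have "x = g [^] ((\<Sum>i<k mod n. q ^ i) + n * (c + i))"
      unfolding i by (simp add: algebra_simps)
    then show "k mod n < n \<and> x \<in> dickson_coset R g q n (k mod n)" using n mem by auto
  next
    fix j assume j: "j < n \<and> x \<in> dickson_coset R g q n j"
    then obtain i' where "x = g [^] ((\<Sum>i<j. q ^ i) + n * i')" using mem by blast
    then have "[(\<Sum>i<j. q ^ i) + n * i' = (\<Sum>i<k. q ^ i) + n * i] (mod order R - 1)"
      using i primitive_element_pow_eq_imp_cong[OF fin g] by metis
    then have "[(\<Sum>i<j. q ^ i) + n * i' = (\<Sum>i<k. q ^ i) + n * i] (mod n)"
      using ndvd cong_dvd_modulus_nat by blast
    then have "[(\<Sum>i<j. q ^ i) = (\<Sum>i<k. q ^ i)] (mod n)" by (simp add: cong_def)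
    then have "[j = k] (mod n)" unfolding cong_iff .
    then show "j = k mod n" using j by (simp add: cong_def)
  qed
qed

theorem theorem19:
  fixes F :: "('a, 'm) ring_scheme" and g b :: 'a and p l q n s t \<mu> :: nat
  assumes "dickson_pair q n"
    and "Factorial_Ring.prime p" and "q = p ^ l"
    and "n > 2"
    and "field F" and "finite (carrier F)" and "order F = q ^ n"
    and "primitive_element F g"
    and "b \<in> carrier (dickson_nearfield F g q n)"
    and "b \<noteq> \<zero>\<^bsub>F\<^esub>" and "\<one>\<^bsub>F\<^esub> \<oplus>\<^bsub>F\<^esub> b \<noteq> \<zero>\<^bsub>F\<^esub>"
    and "b \<in> dickson_coset F g q n s"
    and "\<one>\<^bsub>F\<^esub> \<oplus>\<^bsub>F\<^esub> b \<in> dickson_coset F g q n t"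
    and "\<mu> = gcd s (gcd t n)"
  shows "largest_subfield_in F
           (gen_dist_set (dickson_nearfield F g q n) \<one>\<^bsub>F\<^esub> b) (subfield_of_order F (q ^ \<mu>))
         \<and> (\<forall>K. largest_subfield_in F (gen_dist_set (dickson_nearfield F g q n) \<one>\<^bsub>F\<^esub> b) K
                \<longrightarrow> K = subfield_of_order F (q ^ \<mu>))"
proof -
  interpret F: field F by fact
  let ?D = "gen_dist_set (dickson_nearfield F g q n) \<one>\<^bsub>F\<^esub> b"
  let ?K = "{x \<in> carrier F. x [^]\<^bsub>F\<^esub> (q ^ \<mu>) = x}"
  have b: "b \<in> carrier F" using assms(9) by (simp add: dickson_nearfield_def)
  have "q > 1" using assms(1) by (simp add: dickson_pair_def primepow_gt_Suc_0)
  then have "l > 0" using assms(3) by (cases l) auto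
  have ord: "order F = p ^ (l * n)" using assms(3,7) by (simp add: power_mult)
  have fix_n: "x [^]\<^bsub>F\<^esub> (q ^ n) = x" if "x \<in> carrier F" for x
    using F.subfield_pow_card[OF F.carrier_is_subfield assms(6) that] assms(7) by (simp add: order_def)
  note index = F.dickson_index_eq[OF assms(1,6,7,8)]
  have "\<one>\<^bsub>F\<^esub> \<in> dickson_coset F g q n 0"
    unfolding F.mem_dickson_coset_iff[OF assms(6,8)] by (intro exI[of _ 0]) simp
  then have index_one: "dickson_index F g q n \<one>\<^bsub>F\<^esub> = 0" using index by fastforce
  \<comment> \<open>The indices are \<open>s mod n\<close> and \<open>t mod n\<close>. Since every
    element is fixed by the \<open>q ^ n\<close>-th power, \<open>s\<close> and \<open>t\<close> may
    replace them.\<close>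
  have D: "?D = {d \<in> carrier F. (\<one>\<^bsub>F\<^esub> \<oplus>\<^bsub>F\<^esub> b) \<otimes>\<^bsub>F\<^esub> d [^]\<^bsub>F\<^esub> (q ^ t)
      = d \<oplus>\<^bsub>F\<^esub> b \<otimes>\<^bsub>F\<^esub> d [^]\<^bsub>F\<^esub> (q ^ s)}"
    using assms(10,11) index_one index[OF assms(12)] index[OF assms(13)] fix_n
    by (auto simp: gen_dist_set_def dickson_nearfield_def F.pow_power_mod)
  have "\<mu> dvd n" "\<mu> > 0" using assms(4,14) by (auto intro: dvd_trans)
  then have K: "subfield_of_order F (q ^ \<mu>) = ?K"
    using F.subfield_of_order_eq[OF assms(2,6) ord, of "l * \<mu>"] \<open>l > 0\<close>
    by (simp add: assms(3) mult_dvd_mono flip: power_mult)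
  have subfield: "subfield ?K F"
    using F.subfield_fixed_points[OF assms(2) ord, of "l * \<mu>"] by (simp add: assms(3) power_mult)
  have "?K \<subseteq> ?D"
  proof
    fix d assume "d \<in> ?K"
    then have "d \<in> carrier F" "d [^]\<^bsub>F\<^esub> (q ^ s) = d" "d [^]\<^bsub>F\<^esub> (q ^ t) = d"
      using assms(14) by (auto intro: F.pow_power_dvd)
    then show "d \<in> ?D" unfolding D using b by (simp add: F.l_distr)
  qed
  moreover have "L \<subseteq> ?K" if L: "subfield L F" "L \<subseteq> ?D" for L
  proof
    fix d assume d: "d \<in> L"
    then have dc: "d \<in> carrier F" using L(1) subfieldE(3) by blast
    have "(\<one>\<^bsub>F\<^esub> \<oplus>\<^bsub>F\<^esub> b) \<otimes>\<^bsub>F\<^esub> c [^]\<^bsub>F\<^esub> (q ^ t)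
        = c \<oplus>\<^bsub>F\<^esub> b \<otimes>\<^bsub>F\<^esub> c [^]\<^bsub>F\<^esub> (q ^ s)" if "c \<in> L" for c
      using that L(2) D by blast
    note F.subfield_pow_relation_imp_fixed[OF L(1) b assms(10,11) this d]
    \<comment> \<open>The exponent \<open>n\<close> enters the gcd because the
      \<open>q ^ n\<close>-th power fixes the whole field.\<close>
    then show "d \<in> ?K" using fix_n[OF dc] assms(14) dc by (simp add: F.pow_power_gcd)
  qed
  ultimately have "largest_subfield_in F ?D ?K"
    using subfield unfolding largest_subfield_in_def by blast
  moreover from this have "K = ?K" if "largest_subfield_in F ?D K" for K
    using that unfolding largest_subfield_in_def by blast
  ultimately show ?thesis unfolding K by blast
qed

end
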